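(* Let $n\ge m\ge 2$ be integers and let $\pi=B_1|\cdots|B_m\in\Pi_{n,m}$ be a partition of $[n]=\{1,\dots,n\}$ into $m$ blocks. Then the set of all partitions $\tilde\pi\in\Pi_n$ that are not complementary to $\pi$ is $$\mathcal T^{(n)}_{\pi,m}=\bigl\{\tilde\pi=\tilde\pi_1\cup\tilde\pi_2\in\Pi_n \;\bigm|\; \tilde\pi_1\in\Pi_{A_1},\ \tilde\pi_2\in\Pi_{A_2},\ \text{where } A_1=\textstyle\bigcup_{i\in C_1}B_i \text{ and } A_2=\bigcup_{i\in C_2}B_i \text{ for some partition } C_1|C_2\in\Pi_{m,2} \text{ of } [m] \text{ into two blocks}\bigr\}.$$
   Context: $\Pi_n$ is the set of all set partitions of $[n]$, $\Pi_{n,m}$ the subset of partitions with exactly $m$ (nonempty) blocks, and, for a finite set $A$, $\Pi_A$ is the set of all set partitions of $A$. Partitions are ordered by refinement: $\pi\le\tilde\pi$ if every block of $\pi$ is contained in some block of $\tilde\pi$; $\pi\vee\tilde\pi$ is the least upper bound, i.e. the finest partition refined by both $\pi$ and $\tilde\pi$. $\mathbf 1_n$ is the partition of $[n]$ with the single block $[n]$. Two partitions $\pi,\tilde\pi\in\Pi_n$ are called complementary if $\pi\vee\tilde\pi=\mathbf 1_n$. If $A_1,A_2$ are disjoint with union $[n]$, $\tilde\pi_1\cup\tilde\pi_2$ denotes the partition of $[n]$ whose blocks are the blocks of $\tilde\pi_1$ together with those of $\tilde\pi_2$. *)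

theory Defs
  imports "HOL-Library.Disjoint_Sets" "HOL-Algebra.Lattice"
begin

definition set_partitions :: "'a set \<Rightarrow> 'a set set set"
  where "set_partitions A = {P. partition_on A P}"

text \<open>For \<open>\<Pi>\<^sub>n\<^sub>,\<^sub>m\<close> take \<open>A = {1..n}\<close>. Every partition of a finite set is finite, so
  \<^const>\<open>card\<close> really counts blocks whenever \<open>A\<close> is finite.\<close>

definition set_partitions_card :: "'a set \<Rightarrow> nat \<Rightarrow> 'a set set set"
  where "set_partitions_card A k = {P \<in> set_partitions A. card P = k}"

definition partition_order :: "'a set \<Rightarrow> 'a set set gorder"
  where "partition_order A = \<lparr>carrier = set_partitions A, eq = (=), le = refines A\<rparr>"

definition partition_join :: "'a set \<Rightarrow> 'a set set \<Rightarrow> 'a set set \<Rightarrow> 'a set set"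
  where "partition_join A P Q = P \<squnion>\<^bsub>partition_order A\<^esub> Q"

text \<open>The library's join is a Hilbert choice of a least upper bound. The next two facts show
  that this bound exists and is unique, so the choice is harmless.\<close>

lemma partition_order_partial_order: "partial_order (partition_order A)"
  by unfold_locales
    (auto simp: partition_order_def set_partitions_def
      intro: refines_refl refines_trans dest: subsetD[OF refines_asym1])

lemma partition_join_least:
  assumes "P \<in> set_partitions A" "Q \<in> set_partitions A"
  shows "least (partition_order A) (partition_join A P Q) (Upper (partition_order A) {P, Q})"
proof -
  let ?U = "{R. refines A P R \<and> refines A Q R}"
  have PQ: "partition_on A P" "partition_on A Q"
    using assms by (auto simp: set_partitions_def)
  have U: "partition_on A R" if "R \<in> ?U" for R
    using that by (auto simp: refines_def)
  have ne: "?U \<noteq> {}"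
  proof (cases "A = {}")
    case True
    then have "P = {}" "Q = {}"
      using PQ by (simp_all add: partition_on_empty)
    then show ?thesis using refines_refl PQ by blast
  next
    case False
    then have "refines A P {A}" "refines A Q {A}"
      using PQ partition_on_space[of A] by (auto simp: refines_def partition_on_def)
    then show ?thesis by blast
  qed
  have Up: "Upper (partition_order A) {P, Q} = ?U"
    using PQ by (auto simp: Upper_def partition_order_def set_partitions_def refines_def)
  have "refines A P (common_refinement ?U)" "refines A Q (common_refinement ?U)"
    using PQ U ne by (auto intro!: common_refinement_coarsest)
  moreover have "refines A (common_refinement ?U) R" if "R \<in> ?U" for R
    using U that by (intro refines_common_refinement) auto
  ultimately have "least (partition_order A) (common_refinement ?U) ?U"
    using U by (auto simp: least_def partition_order_def set_partitions_def)
  then show ?thesis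
    unfolding partition_join_def join_def sup_def Up by (rule someI)
qed

definition one_partition :: "nat \<Rightarrow> nat set set"
  where "one_partition n = {{1..n}}"

definition complementary :: "nat \<Rightarrow> nat set set \<Rightarrow> nat set set \<Rightarrow> bool"
  where "complementary n P Q \<longleftrightarrow> partition_join {1..n} P Q = one_partition n"

text \<open>The set \<open>\<T>\<^sup>(\<^sup>n\<^sup>)\<^sub>\<pi>\<^sub>,\<^sub>m\<close>, where \<open>\<pi> = B\<^sub>1|\<dots>|B\<^sub>m\<close> enters through its enumerated blocks.\<close>

definition split_partitions :: "nat \<Rightarrow> nat \<Rightarrow> (nat \<Rightarrow> nat set) \<Rightarrow> nat set set set"
  where "split_partitions n m B =
    {P \<in> set_partitions {1..n}. \<exists>P1 P2 A1 A2 C1 C2.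
       P = P1 \<union> P2 \<and> P1 \<in> set_partitions A1 \<and> P2 \<in> set_partitions A2 \<and>
       A1 = (\<Union>i\<in>C1. B i) \<and> A2 = (\<Union>i\<in>C2. B i) \<and>
       {C1, C2} \<in> set_partitions_card {1..m} 2}"

end

theory Submission
  imports Defs
begin

text \<open>Both directions pass through sets that are unions of blocks of both partitions. A block of
  the join is such a set, and it is proper unless the join is trivial. Conversely, a proper nonempty
  such set \<open>X\<close> yields the common upper bound consisting of \<open>X\<close> and its complement, so the join is
  not the one-block partition.\<close>

text \<open>For \<open>P\<close> a partition of \<open>A\<close> and \<open>X \<subseteq> A\<close>,
  this is a blockwise way of saying that \<open>X\<close> is a union of blocks of
  \<open>P\<close>.\<close>

definition saturated :: "'a set set \<Rightarrow> 'a set \<Rightarrow> bool"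
  where "saturated P X \<longleftrightarrow> (\<forall>p\<in>P. p \<subseteq> X \<or> p \<inter> X = {})"

text \<open>Used with \<open>R\<close> the join of two partitions: since both refine it, each of its
  blocks is saturated for both.\<close>

lemma saturated_if_refines:
  assumes "refines A P R" "X \<in> R"
  shows "saturated P X"
  unfolding saturated_def
proof
  fix p assume "p \<in> P"
  with assms(1) obtain Y where Y: "Y \<in> R" "p \<subseteq> Y"
    by (auto simp: refines_def)
  moreover have "Y = X \<or> Y \<inter> X = {}"
    using assms Y(1) by (auto simp: refines_def partition_on_def dest: disjointD)
  ultimately show "p \<subseteq> X \<or> p \<inter> X = {}" by blast
qed

lemma refines_split_if_saturated:
  assumes "partition_on A P" "saturated P X" "X \<noteq> {}" "X \<subset> A"
  shows "refines A P {X, A - X}"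
proof -
  have "partition_on A {X, A - X}"
    using assms by (auto simp: partition_on_def disjoint_def)
  moreover have "\<exists>Y\<in>{X, A - X}. p \<subseteq> Y" if "p \<in> P" for p
    using that assms partition_onD1[OF assms(1)] by (auto simp: saturated_def)
  ultimately show ?thesis
    using assms(1) by (auto simp: refines_def)
qed

text \<open>Cutting \<open>P\<close> along \<open>X\<close> breaks no block, since a block not
  inside \<open>X\<close> misses it. The two pieces later serve as \<open>P1\<close> and
  \<open>P2\<close>.\<close>

lemma partition_on_split_saturated:
  assumes "partition_on A P" "saturated P X" "X \<subseteq> A"
  shows "partition_on X {p \<in> P. p \<subseteq> X}" "partition_on (A - X) {p \<in> P. \<not> p \<subseteq> X}"
proof -
  have P: "\<Union>P = A" "disjoint P" "{} \<notin> P"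
    using assms(1) by (auto simp: partition_on_def)
  have "\<Union>{p \<in> P. p \<subseteq> X} = X"
    using P(1) assms(2,3) unfolding saturated_def by blast
  then show "partition_on X {p \<in> P. p \<subseteq> X}"
    using P(2,3) by (auto simp: partition_on_def disjoint_def)
  have "\<Union>{p \<in> P. \<not> p \<subseteq> X} = A - X"
    using P(1) assms(2) unfolding saturated_def by blast
  then show "partition_on (A - X) {p \<in> P. \<not> p \<subseteq> X}"
    using P(2,3) by (auto simp: partition_on_def disjoint_def)
qed

lemma partition_join_upper:
  assumes "partition_on A P" "partition_on A Q"
  shows "refines A P (partition_join A P Q)" "refines A Q (partition_join A P Q)"
  using partition_join_least[of P A Q] assms
  by (auto simp: set_partitions_def least_def Upper_def partition_order_def)

lemma partition_join_refines:
  assumes "refines A P R" "refines A Q R"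
  shows "refines A (partition_join A P Q) R"
proof -
  have "partition_on A P" "partition_on A Q" "partition_on A R"
    using assms by (auto simp: refines_def)
  then show ?thesis
    using partition_join_least[of P A Q] assms
    by (auto simp: set_partitions_def least_def Upper_def partition_order_def)
qed

lemma partition_on_space_member:
  assumes "partition_on A P" "A \<in> P"
  shows "P = {A}"
proof -
  have "p = A" if "p \<in> P" for p
  proof -
    have "p \<noteq> {}" "p \<subseteq> A"
      using assms(1) that by (auto simp: partition_on_def)
    then show ?thesis
      using assms that unfolding partition_on_def disjoint_def by blast
  qed
  with assms(2) show ?thesis by blast
qed

text \<open>This removes the join from the notion of complementarity. The case \<open>A = {}\<close>
  has to be excluded: there the join is \<open>{}\<close>, which differs from \<open>{A}\<close>,
  yet no \<open>X\<close> exists.\<close>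

lemma partition_join_nontrivial_iff:
  assumes P: "partition_on A P" and Q: "partition_on A Q" and "A \<noteq> {}"
  shows "partition_join A P Q \<noteq> {A} \<longleftrightarrow>
    (\<exists>X. X \<noteq> {} \<and> X \<subset> A \<and> saturated P X \<and> saturated Q X)"
    (is "?J \<noteq> _ \<longleftrightarrow> ?S")
proof
  assume ne: "?J \<noteq> {A}"
  note up = partition_join_upper[OF P Q]
  have J: "partition_on A ?J" using up by (simp add: refines_def)
  with \<open>A \<noteq> {}\<close> obtain X where X: "X \<in> ?J"
    by (auto simp: partition_on_def)
  have "X \<noteq> A" using partition_on_space_member[OF J] X ne by blast
  moreover have "X \<noteq> {}" "X \<subseteq> A" using J X by (auto simp: partition_on_def)
  ultimately show ?S using saturated_if_refines[OF _ X] up by blast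
next
  assume ?S
  then obtain X where X: "X \<noteq> {}" "X \<subset> A" "saturated P X" "saturated Q X" by blast
  then have "refines A ?J {X, A - X}"
    using P Q by (intro partition_join_refines refines_split_if_saturated)
  \<comment> \<open>If the join were \<open>{A}\<close>, then \<open>A\<close> would lie inside
    \<open>X\<close> or inside \<open>A - X\<close>, both of which are proper subsets.\<close>
  with X show "?J \<noteq> {A}"
    by (auto simp: refines_def)
qed

text \<open>Both sides exclude \<open>C = D\<close>: on the left \<open>{C, D}\<close> would have
  one element, on the right a nonempty set would be disjoint from itself.\<close>

lemma two_block_partition_iff:
  "{C, D} \<in> set_partitions_card I 2 \<longleftrightarrow> C \<noteq> {} \<and> D \<noteq> {} \<and> C \<inter> D = {} \<and> C \<union> D = I"
  by (cases "C = D") (auto simp: set_partitions_card_def set_partitions_def partition_on_def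
      disjoint_def)

text \<open>The index sets are traded for the single set \<open>X\<close>, the union of the
  \<open>B i\<close> over \<open>C1\<close>. Injectivity of \<open>B\<close> ensures that disjoint
  index sets give disjoint unions.\<close>

lemma split_partitions_iff:
  assumes part: "partition_on {1..n} (B ` {1..m})" and inj: "inj_on B {1..m}"
  shows "P \<in> split_partitions n m B \<longleftrightarrow> partition_on {1..n} P \<and>
    (\<exists>X. X \<noteq> {} \<and> X \<subset> {1..n} \<and> saturated (B ` {1..m}) X \<and> saturated P X)"
proof -
  have ne: "B i \<noteq> {}" if "i \<in> {1..m}" for i
    using part that unfolding partition_on_def by (metis imageI)
  have disj: "B i \<inter> B j = {}" if "i \<in> {1..m}" "j \<in> {1..m}" "i \<noteq> j" for i j
  proof (rule disjointD)
    show "disjoint (B ` {1..m})" using part by (simp add: partition_on_def)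
    show "B i \<noteq> B j" using that inj by (simp add: inj_on_eq_iff)
  qed (use that in auto)
  have cover: "(\<Union>i\<in>{1..m}. B i) = {1..n}"
    using part by (simp add: partition_on_def)
  show ?thesis
  proof
    assume "P \<in> split_partitions n m B"
    then obtain P1 P2 C1 C2 where P: "partition_on {1..n} P" "P = P1 \<union> P2"
      and P12: "partition_on (\<Union>i\<in>C1. B i) P1" "partition_on (\<Union>i\<in>C2. B i) P2"
      and C: "C1 \<noteq> {}" "C2 \<noteq> {}" "C1 \<inter> C2 = {}" "C1 \<union> C2 = {1..m}"
      unfolding split_partitions_def two_block_partition_iff set_partitions_def by blast
    let ?X = "\<Union>i\<in>C1. B i" and ?Y = "\<Union>i\<in>C2. B i"
    have XY: "?X \<inter> ?Y = {}" using disj C by blast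
    have "?X \<union> ?Y = {1..n}" using cover C(4) by (simp flip: UN_Un)
    moreover have "?X \<noteq> {}" "?Y \<noteq> {}" using ne C(1,2) unfolding C(4)[symmetric] by auto
    ultimately have "?X \<noteq> {}" "?X \<subset> {1..n}" using XY by blast+
    moreover have "saturated (B ` {1..m}) ?X"
      unfolding saturated_def using XY C(4) by blast
    moreover have "saturated P ?X"
      unfolding saturated_def P(2)
    proof
      fix p assume "p \<in> P1 \<union> P2"
      then have "p \<subseteq> ?X \<or> p \<subseteq> ?Y"
        using partition_onD1[OF P12(1)] partition_onD1[OF P12(2)] by auto
      with XY show "p \<subseteq> ?X \<or> p \<inter> ?X = {}" by blast
    qed
    ultimately show "partition_on {1..n} P \<and>
      (\<exists>X. X \<noteq> {} \<and> X \<subset> {1..n} \<and> saturated (B ` {1..m}) X \<and> saturated P X)"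
      using P(1) by (intro conjI exI[of _ ?X])
  next
    assume "partition_on {1..n} P \<and>
      (\<exists>X. X \<noteq> {} \<and> X \<subset> {1..n} \<and> saturated (B ` {1..m}) X \<and> saturated P X)"
    then obtain X where P: "partition_on {1..n} P"
      and X: "X \<noteq> {}" "X \<subset> {1..n}" "saturated (B ` {1..m}) X" "saturated P X"
      by blast
    \<comment> \<open>The indices are sorted by whether their block lies inside \<open>X\<close>; by
      saturation the blocks of the second kind are disjoint from \<open>X\<close>.\<close>
    define C1 C2 where "C1 = {i \<in> {1..m}. B i \<subseteq> X}" and "C2 = {i \<in> {1..m}. \<not> B i \<subseteq> X}"
    have out: "B i \<inter> X = {}" if "i \<in> {1..m}" "\<not> B i \<subseteq> X" for i
      using X(3) that unfolding saturated_def by blast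
    have A1: "X = (\<Union>i\<in>C1. B i)"
    proof (intro equalityI subsetI)
      fix x assume x: "x \<in> X"
      with X(2) have "x \<in> (\<Union>i\<in>{1..m}. B i)" unfolding cover by blast
      then obtain i where "i \<in> {1..m}" "x \<in> B i" by blast
      with x out[of i] show "x \<in> (\<Union>i\<in>C1. B i)" by (auto simp: C1_def)
    qed (auto simp: C1_def)
    have A2: "{1..n} - X = (\<Union>i\<in>C2. B i)"
      unfolding cover[symmetric] using out by (fastforce simp: C2_def)
    \<comment> \<open>A point of \<open>X\<close> forces an index in \<open>C1\<close>, a point of
      \<open>{1..n}\<close> outside \<open>X\<close> one in \<open>C2\<close>.\<close>
    have "C1 \<noteq> {}" "C2 \<noteq> {}" using X(1) A1 A2 psubset_imp_ex_mem[OF X(2)] by blast+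
    then have C: "{C1, C2} \<in> set_partitions_card {1..m} 2"
      unfolding two_block_partition_iff by (auto simp: C1_def C2_def)
    note split = partition_on_split_saturated[OF P X(4) psubset_imp_subset[OF X(2)]]
    have decomp: "P = {p \<in> P. p \<subseteq> X} \<union> {p \<in> P. \<not> p \<subseteq> X}" by blast
    show "P \<in> split_partitions n m B"
      unfolding split_partitions_def set_partitions_def mem_Collect_eq
      \<comment> \<open>The six witnesses stay schematic and are fixed by unification with the
        assembled conjunction.\<close>
      by (rule conjI[OF P], (rule exI)+)
        (rule conjI[OF decomp conjI[OF split(1) conjI[OF split(2) conjI[OF A1 conjI[OF A2 C]]]]])
  qed
qed

theorem theorem3p2:
  fixes n m :: nat and \<pi> :: "nat set set" and B :: "nat \<Rightarrow> nat set"
  assumes "2 \<le> m" and "m \<le> n"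
    and "\<pi> \<in> set_partitions_card {1..n} m"
    and "\<pi> = B ` {1..m}"
  shows "{\<pi>' \<in> set_partitions {1..n}. \<not> complementary n \<pi> \<pi>'} = split_partitions n m B"
proof -
  have part: "partition_on {1..n} \<pi>" and "card \<pi> = m"
    using assms(3) by (auto simp: set_partitions_card_def set_partitions_def)
  \<comment> \<open>The \<open>m\<close> indices have an image of size \<open>m\<close>, so no block
    is listed twice.\<close>
  then have inj: "inj_on B {1..m}"
    using assms(4) by (simp add: eq_card_imp_inj_on)
  have ne: "{1..n} \<noteq> {}" using assms(1,2) by simp
  have "\<pi>' \<in> set_partitions {1..n} \<and> \<not> complementary n \<pi> \<pi>' \<longleftrightarrow> \<pi>' \<in> split_partitions n m B" for \<pi>'
    unfolding split_partitions_iff[OF part[unfolded assms(4)] inj] complementary_def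
      one_partition_def set_partitions_def mem_Collect_eq assms(4)[symmetric]
    by (rule conj_cong[OF refl partition_join_nontrivial_iff[OF part _ ne]])
  then show ?thesis by blast
qed

end
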